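(* Let $\mathscr{R}$ be a finite von Neumann algebra with a faithful normal tracial state $\tau$, let $\mathscr{S}$ be a von Neumann subalgebra of $\mathscr{R}$, and let $\Phi:\mathscr{R}\to\mathscr{S}$ be a $\tau$-preserving conditional expectation from $\mathscr{R}$ onto $\mathscr{S}$. For a self-adjoint operator $A$ in $\mathscr{R}$, $$\Phi(A)^2\le\Phi(A^2).$$ If $A$ is positive and regular, then $$\Phi(A)^{-1}\le\Phi(A^{-1}).$$ Further, in each of these two inequalities, equality holds if and only if $\Phi(A)=A$, i.e. $A\in\mathscr{S}$ (for the $A$ under consideration).
   Context: Von Neumann algebras act on a separable complex Hilbert space and contain the identity operator $I$; $\mathscr{S}$ contains the identity $I$ of $\mathscr{R}$. "Regular" means invertible (with bounded inverse). Conditional expectation: a map $\Phi:\mathscr{R}\to\mathscr{S}$ that is linear, positive, with $\Phi(I)=I$, and $\Phi(S_1RS_2)=S_1\Phi(R)S_2$ for all $R\in\mathscr{R}$, $S_1,S_2\in\mathscr{S}$. It is $\tau$-preserving if $\tau(\Phi(R))=\tau(R)$ for all $R\in\mathscr{R}$. *)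

theory Defs
  imports "HOL-Analysis.Analysis"
begin

section \<open>Complex Hilbert spaces\<close>

text \<open>The inner product is linear in its first argument. Its real part is the library's real
  inner product, so the norm is the square root of \<open>cinner x x\<close>.\<close>

class chilbert_space = real_inner + complete_space +
  fixes scaleC :: "complex \<Rightarrow> 'a \<Rightarrow> 'a"  (infixr \<open>*\<^sub>C\<close> 75)
    and cinner :: "'a \<Rightarrow> 'a \<Rightarrow> complex"
  assumes scaleC_add_right: "a *\<^sub>C (x + y) = a *\<^sub>C x + a *\<^sub>C y"
    and scaleC_add_left: "(a + b) *\<^sub>C x = a *\<^sub>C x + b *\<^sub>C x"
    and scaleC_scaleC: "a *\<^sub>C (b *\<^sub>C x) = (a * b) *\<^sub>C x"
    and scaleC_of_real: "complex_of_real r *\<^sub>C x = r *\<^sub>R x"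
    and cinner_add_left: "cinner (x + y) z = cinner x z + cinner y z"
    and cinner_scaleC_left: "cinner (a *\<^sub>C x) y = a * cinner x y"
    and cinner_commute: "cinner x y = cnj (cinner y x)"
    and inner_eq_Re_cinner: "inner x y = Re (cinner x y)"

instantiation complex :: chilbert_space
begin

definition scaleC_complex :: "complex \<Rightarrow> complex \<Rightarrow> complex"
  where "scaleC_complex a x = a * x"

definition cinner_complex :: "complex \<Rightarrow> complex \<Rightarrow> complex"
  where "cinner_complex x y = x * cnj y"

instance
  by standard
    (simp_all add: scaleC_complex_def cinner_complex_def algebra_simps scaleR_conv_of_real
      inner_complex_def)

end

lemma norm_scaleC: "norm (c *\<^sub>C (x::'a::chilbert_space)) = cmod c * norm x"
proof -
  have real: "Im (cinner x x) = 0"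
    using arg_cong[OF cinner_commute[of x x], of Im] by simp
  have "cinner (c *\<^sub>C x) (c *\<^sub>C x) = c * cnj c * cinner x x"
    by (metis cinner_commute cinner_scaleC_left complex_cnj_mult mult.assoc)
  hence "inner (c *\<^sub>C x) (c *\<^sub>C x) = (cmod c)\<^sup>2 * inner x x"
    using real by (simp add: inner_eq_Re_cinner complex_mult_cnj cmod_power2)
  thus ?thesis
    by (simp add: norm_eq_sqrt_inner real_sqrt_mult)
qed

section \<open>Bounded operators\<close>

text \<open>The library type \<open>'h \<Rightarrow>\<^sub>L 'h\<close> consists of the bounded real-linear maps; the bounded
  operators of a complex Hilbert space are its complex-linear elements.\<close>

definition bounded_ops :: "('h::chilbert_space \<Rightarrow>\<^sub>L 'h) set"
  where "bounded_ops = {T :: 'h \<Rightarrow>\<^sub>L 'h. \<forall>c x. T (c *\<^sub>C x) = c *\<^sub>C T x}"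

lift_definition scale_op :: "complex \<Rightarrow> ('h::chilbert_space \<Rightarrow>\<^sub>L 'h) \<Rightarrow> ('h \<Rightarrow>\<^sub>L 'h)"
  is "\<lambda>c T x. c *\<^sub>C T x"
proof -
  fix c :: complex and T :: "'h \<Rightarrow> 'h"
  assume T: "bounded_linear T"
  have "bounded_linear (\<lambda>x::'h. c *\<^sub>C x)"
    by (rule bounded_linear_intro[where K = "cmod c"])
      (simp_all add: scaleC_add_right scaleC_scaleC norm_scaleC mult.commute
        flip: scaleC_of_real)
  thus "bounded_linear (\<lambda>x. c *\<^sub>C T x)"
    using T by (rule bounded_linear_compose)
qed

definition is_adjoint :: "('h::chilbert_space \<Rightarrow>\<^sub>L 'h) \<Rightarrow> ('h \<Rightarrow>\<^sub>L 'h) \<Rightarrow> bool"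
  where "is_adjoint T T' \<longleftrightarrow> T' \<in> bounded_ops \<and> (\<forall>x y. cinner (T x) y = cinner x (T' y))"

definition self_adjoint :: "('h::chilbert_space \<Rightarrow>\<^sub>L 'h) \<Rightarrow> bool"
  where "self_adjoint T \<longleftrightarrow> is_adjoint T T"

definition positive_op :: "('h::chilbert_space \<Rightarrow>\<^sub>L 'h) \<Rightarrow> bool"
  where "positive_op T \<longleftrightarrow>
    T \<in> bounded_ops \<and> (\<forall>x. cinner (T x) x \<in> \<real> \<and> 0 \<le> Re (cinner (T x) x))"

definition op_le :: "('h::chilbert_space \<Rightarrow>\<^sub>L 'h) \<Rightarrow> ('h \<Rightarrow>\<^sub>L 'h) \<Rightarrow> bool"  (infix \<open>\<preceq>\<close> 50)
  where "T \<preceq> U \<longleftrightarrow> positive_op (U - T)"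

definition is_inverse_op :: "('h::chilbert_space \<Rightarrow>\<^sub>L 'h) \<Rightarrow> ('h \<Rightarrow>\<^sub>L 'h) \<Rightarrow> bool"
  where "is_inverse_op T U \<longleftrightarrow>
    U \<in> bounded_ops \<and> T o\<^sub>L U = id_blinfun \<and> U o\<^sub>L T = id_blinfun"

definition regular_op :: "('h::chilbert_space \<Rightarrow>\<^sub>L 'h) \<Rightarrow> bool"
  where "regular_op T \<longleftrightarrow> (\<exists>U. is_inverse_op T U)"

text \<open>Only meaningful for regular operators.\<close>

definition inverse_op :: "('h::chilbert_space \<Rightarrow>\<^sub>L 'h) \<Rightarrow> ('h \<Rightarrow>\<^sub>L 'h)"
  where "inverse_op T = (THE U. is_inverse_op T U)"

section \<open>Von Neumann algebras\<close>

text \<open>The coarsest topology on the bounded operators making every matrix coefficient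
  \<open>T \<mapsto> cinner (T x) y\<close> continuous: \<open>euclidean\<close> is here the product topology on functions
  \<open>'h \<times> 'h \<Rightarrow> complex\<close>.\<close>

definition weak_operator_topology :: "('h::chilbert_space \<Rightarrow>\<^sub>L 'h) topology"
  where "weak_operator_topology =
    pullback_topology bounded_ops (\<lambda>T (x, y). cinner (T x) y) euclidean"

definition von_neumann_algebra :: "('h::chilbert_space \<Rightarrow>\<^sub>L 'h) set \<Rightarrow> bool"
  where "von_neumann_algebra R \<longleftrightarrow>
    R \<subseteq> bounded_ops \<and>
    id_blinfun \<in> R \<and>
    (\<forall>T\<in>R. \<forall>U\<in>R. T + U \<in> R \<and> T o\<^sub>L U \<in> R) \<and>
    (\<forall>c. \<forall>T\<in>R. scale_op c T \<in> R) \<and>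
    (\<forall>T\<in>R. \<exists>T'\<in>R. is_adjoint T T') \<and>
    closedin weak_operator_topology R"

definition projection_op :: "('h::chilbert_space \<Rightarrow>\<^sub>L 'h) \<Rightarrow> bool"
  where "projection_op E \<longleftrightarrow> self_adjoint E \<and> E o\<^sub>L E = E"

text \<open>Murray--von Neumann equivalence relative to \<open>R\<close>, and finiteness of projections in \<open>R\<close>.\<close>

definition proj_equiv ::
  "('h::chilbert_space \<Rightarrow>\<^sub>L 'h) set \<Rightarrow> ('h \<Rightarrow>\<^sub>L 'h) \<Rightarrow> ('h \<Rightarrow>\<^sub>L 'h) \<Rightarrow> bool"
  where "proj_equiv R E F \<longleftrightarrow>
    (\<exists>V\<in>R. \<exists>V'\<in>R. is_adjoint V V' \<and> V' o\<^sub>L V = E \<and> V o\<^sub>L V' = F)"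

definition finite_projection ::
  "('h::chilbert_space \<Rightarrow>\<^sub>L 'h) set \<Rightarrow> ('h \<Rightarrow>\<^sub>L 'h) \<Rightarrow> bool"
  where "finite_projection R E \<longleftrightarrow>
    E \<in> R \<and> projection_op E \<and>
    (\<forall>F\<in>R. projection_op F \<and> F \<preceq> E \<and> proj_equiv R E F \<longrightarrow> F = E)"

definition finite_von_neumann_algebra :: "('h::chilbert_space \<Rightarrow>\<^sub>L 'h) set \<Rightarrow> bool"
  where "finite_von_neumann_algebra R \<longleftrightarrow>
    von_neumann_algebra R \<and> finite_projection R id_blinfun"

section \<open>Tracial states\<close>

definition state_on ::
  "('h::chilbert_space \<Rightarrow>\<^sub>L 'h) set \<Rightarrow> (('h \<Rightarrow>\<^sub>L 'h) \<Rightarrow> complex) \<Rightarrow> bool"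
  where "state_on R \<tau> \<longleftrightarrow>
    (\<forall>T\<in>R. \<forall>U\<in>R. \<tau> (T + U) = \<tau> T + \<tau> U) \<and>
    (\<forall>c. \<forall>T\<in>R. \<tau> (scale_op c T) = c * \<tau> T) \<and>
    (\<forall>T\<in>R. positive_op T \<longrightarrow> \<tau> T \<in> \<real> \<and> 0 \<le> Re (\<tau> T)) \<and>
    \<tau> id_blinfun = 1"

definition tracial_on ::
  "('h::chilbert_space \<Rightarrow>\<^sub>L 'h) set \<Rightarrow> (('h \<Rightarrow>\<^sub>L 'h) \<Rightarrow> complex) \<Rightarrow> bool"
  where "tracial_on R \<tau> \<longleftrightarrow> (\<forall>T\<in>R. \<forall>U\<in>R. \<tau> (T o\<^sub>L U) = \<tau> (U o\<^sub>L T))"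

definition faithful_on ::
  "('h::chilbert_space \<Rightarrow>\<^sub>L 'h) set \<Rightarrow> (('h \<Rightarrow>\<^sub>L 'h) \<Rightarrow> complex) \<Rightarrow> bool"
  where "faithful_on R \<tau> \<longleftrightarrow> (\<forall>T\<in>R. positive_op T \<and> \<tau> T = 0 \<longrightarrow> T = 0)"

definition is_lub_in ::
  "('h::chilbert_space \<Rightarrow>\<^sub>L 'h) set \<Rightarrow> ('h \<Rightarrow>\<^sub>L 'h) set \<Rightarrow> ('h \<Rightarrow>\<^sub>L 'h) \<Rightarrow> bool"
  where "is_lub_in R D H \<longleftrightarrow>
    H \<in> R \<and> self_adjoint H \<and> (\<forall>K\<in>D. K \<preceq> H) \<and>
    (\<forall>L\<in>R. self_adjoint L \<and> (\<forall>K\<in>D. K \<preceq> L) \<longrightarrow> H \<preceq> L)"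

text \<open>Normality: \<open>\<tau>\<close> converges to \<open>\<tau> H\<close> along every increasing net of self-adjoint operators
  in \<open>R\<close> with least upper bound \<open>H\<close>. An increasing net is represented by its upward directed
  range \<open>D\<close>, indexed by itself; the filter below is the filter of tails of this net.\<close>

definition normal_on ::
  "('h::chilbert_space \<Rightarrow>\<^sub>L 'h) set \<Rightarrow> (('h \<Rightarrow>\<^sub>L 'h) \<Rightarrow> complex) \<Rightarrow> bool"
  where "normal_on R \<tau> \<longleftrightarrow>
    (\<forall>D H. D \<noteq> {} \<and> D \<subseteq> R \<and> (\<forall>K\<in>D. self_adjoint K) \<and>
           (\<forall>K\<in>D. \<forall>L\<in>D. \<exists>M\<in>D. K \<preceq> M \<and> L \<preceq> M) \<and> is_lub_in R D H
       \<longrightarrow> (\<tau> \<longlongrightarrow> \<tau> H) (INF K\<in>D. principal {L\<in>D. K \<preceq> L}))"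

definition faithful_normal_tracial_state ::
  "('h::chilbert_space \<Rightarrow>\<^sub>L 'h) set \<Rightarrow> (('h \<Rightarrow>\<^sub>L 'h) \<Rightarrow> complex) \<Rightarrow> bool"
  where "faithful_normal_tracial_state R \<tau> \<longleftrightarrow>
    state_on R \<tau> \<and> tracial_on R \<tau> \<and> faithful_on R \<tau> \<and> normal_on R \<tau>"

section \<open>Conditional expectations\<close>

definition conditional_expectation ::
  "('h::chilbert_space \<Rightarrow>\<^sub>L 'h) set \<Rightarrow> ('h \<Rightarrow>\<^sub>L 'h) set \<Rightarrow> (('h \<Rightarrow>\<^sub>L 'h) \<Rightarrow> ('h \<Rightarrow>\<^sub>L 'h)) \<Rightarrow> bool"
  where "conditional_expectation R S \<Phi> \<longleftrightarrow>
    \<Phi> \<in> R \<rightarrow> S \<and>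
    (\<forall>T\<in>R. \<forall>U\<in>R. \<Phi> (T + U) = \<Phi> T + \<Phi> U) \<and>
    (\<forall>c. \<forall>T\<in>R. \<Phi> (scale_op c T) = scale_op c (\<Phi> T)) \<and>
    (\<forall>T\<in>R. positive_op T \<longrightarrow> positive_op (\<Phi> T)) \<and>
    \<Phi> id_blinfun = id_blinfun \<and>
    (\<forall>T\<in>R. \<forall>S1\<in>S. \<forall>S2\<in>S. \<Phi> (S1 o\<^sub>L T o\<^sub>L S2) = S1 o\<^sub>L \<Phi> T o\<^sub>L S2)"

definition trace_preserving ::
  "('h::chilbert_space \<Rightarrow>\<^sub>L 'h) set \<Rightarrow> (('h \<Rightarrow>\<^sub>L 'h) \<Rightarrow> complex) \<Rightarrow> (('h \<Rightarrow>\<^sub>L 'h) \<Rightarrow> ('h \<Rightarrow>\<^sub>L 'h)) \<Rightarrow> bool"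
  where "trace_preserving R \<tau> \<Phi> \<longleftrightarrow> (\<forall>T\<in>R. \<tau> (\<Phi> T) = \<tau> T)"

end

theory Submission
  imports Defs
begin

text \<open>With \<open>B = \<Phi>(A)\<close>, the bimodule property gives
  \<open>\<Phi>((A - B)\<^sup>2) = \<Phi>(A\<^sup>2) - B\<^sup>2\<close> for self-adjoint \<open>A\<close>, and, with \<open>D\<close> and \<open>C\<close> the inverses of
  \<open>A\<close> and \<open>B\<close>, \<open>\<Phi>((D - C) A (D - C)) = \<Phi>(D) - C\<close> for positive regular \<open>A\<close>. Both arguments of
  \<open>\<Phi>\<close> are positive, and since \<open>\<tau>\<close> is faithful and \<open>\<Phi>\<close> preserves it, equality forces them to
  vanish, that is, \<open>A = B\<close> and \<open>D = C\<close>. The inverses lie in the algebras because a von Neumann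
  algebra is norm closed and \<open>A\<close>, \<open>B\<close> are bounded below.\<close>

section \<open>Complex structure, self-adjointness and positivity\<close>

instance chilbert_space \<subseteq> banach ..

lemma blinfun_compose_id [simp]: "T o\<^sub>L id_blinfun = T" "id_blinfun o\<^sub>L T = T"
  by (simp_all add: blinfun_eqI)

lemma scaleC_minus_right: "a *\<^sub>C (x - y) = a *\<^sub>C x - a *\<^sub>C (y::'a::chilbert_space)"
  by (metis add_diff_cancel_right' diff_add_cancel scaleC_add_right)

lemma bounded_linear_scaleC: "bounded_linear (\<lambda>x::'a::chilbert_space. c *\<^sub>C x)"
  by (rule bounded_linear_intro[where K = "cmod c"])
    (simp_all add: scaleC_add_right scaleC_scaleC norm_scaleC mult.commute
      flip: scaleC_of_real)

lemma cinner_scaleC_right: "cinner x (a *\<^sub>C y) = cnj a * cinner x y"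
  by (metis cinner_commute cinner_scaleC_left complex_cnj_mult)

text \<open>Moving \<open>\<i>\<close> out of the second argument multiplies by
  \<open>-\<i>\<close>, which turns the imaginary part into a real part. Complex identities thus
  reduce to the real \<open>inner\<close>.\<close>

lemma cinner_eq_Complex: "cinner x y = Complex (inner x y) (inner x (\<i> *\<^sub>C y))"
  by (simp add: complex_eq_iff inner_eq_Re_cinner cinner_scaleC_right)

lemma inner_ii_ii: "inner (\<i> *\<^sub>C x) (\<i> *\<^sub>C y) = inner x (y::'a::chilbert_space)"
  by (simp add: inner_eq_Re_cinner cinner_scaleC_left cinner_scaleC_right)

lemma scale_op_of_real: "scale_op (complex_of_real r) T = r *\<^sub>R T"
  by (rule blinfun_eqI) (simp add: scale_op.rep_eq scaleC_of_real blinfun.scaleR_left)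

text \<open>Real symmetry suffices: \<open>T\<close> commutes with \<open>\<i>\<close>, so symmetry
  at \<open>\<i> *\<^sub>C y\<close> supplies the imaginary part.\<close>

lemma self_adjoint_iff:
  "self_adjoint T \<longleftrightarrow> T \<in> bounded_ops \<and> (\<forall>x y. inner (T x) y = inner x (T y))"
  (is "?L \<longleftrightarrow> ?R")
proof
  assume ?L
  thus ?R by (simp add: self_adjoint_def is_adjoint_def inner_eq_Re_cinner)
next
  assume R: ?R
  hence "inner (T x) (\<i> *\<^sub>C y) = inner x (\<i> *\<^sub>C T y)" for x y
    by (simp add: bounded_ops_def)
  with R show ?L
    by (simp add: self_adjoint_def is_adjoint_def cinner_eq_Complex)
qed

text \<open>Self-adjointness of a positive operator comes from polarization, applied here to the
  imaginary part of \<open>\<langle>T x, y\<rangle>\<close>.\<close>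

lemma positive_op_iff: "positive_op T \<longleftrightarrow> self_adjoint T \<and> (\<forall>x. 0 \<le> inner (T x) x)"
proof
  assume T: "positive_op T"
  hence lin: "T (c *\<^sub>C x) = c *\<^sub>C T x" for c x
    by (simp add: positive_op_def bounded_ops_def)
  define h where "h x y = inner (T x) (\<i> *\<^sub>C y)" for x y
  have h0: "h x x = 0" for x
    using T by (auto simp: positive_op_def h_def cinner_eq_Complex complex_is_Real_iff)
  have sym: "h x y + h y x = 0" for x y
    using h0[of "x + y"] h0[of x] h0[of y]
    by (simp add: h_def blinfun.add_right inner_add scaleC_add_right)
  \<comment> \<open>At \<open>\<i> *\<^sub>C y\<close> the two terms of \<open>sym\<close> become
    \<open>- inner (T x) y\<close> and \<open>inner (T y) x\<close>.\<close>
  have "inner (T x) y = inner x (T y)" for x y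
    using sym[of x "\<i> *\<^sub>C y"]
    by (simp add: h_def lin inner_ii_ii scaleC_scaleC inner_commute
        scaleC_of_real[of "-1", simplified])
  thus "self_adjoint T \<and> (\<forall>x. 0 \<le> inner (T x) x)"
    using T by (simp add: self_adjoint_iff positive_op_def inner_eq_Re_cinner)
next
  assume T: "self_adjoint T \<and> (\<forall>x. 0 \<le> inner (T x) x)"
  hence "cinner (T x) x = cnj (cinner (T x) x)" for x
    by (metis self_adjoint_def is_adjoint_def cinner_commute)
  hence "cinner (T x) x \<in> \<real>" for x
    by (metis Reals_cnj_iff)
  thus "positive_op T"
    using T unfolding positive_op_def self_adjoint_iff inner_eq_Re_cinner by blast
qed

lemma self_adjoint_diff: "self_adjoint T \<Longrightarrow> self_adjoint U \<Longrightarrow> self_adjoint (T - U)"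
  by (simp add: self_adjoint_iff bounded_ops_def blinfun.diff_left inner_diff scaleC_minus_right)

lemma self_adjoint_add: "self_adjoint T \<Longrightarrow> self_adjoint U \<Longrightarrow> self_adjoint (T + U)"
  by (simp add: self_adjoint_iff bounded_ops_def blinfun.add_left inner_add scaleC_add_right)

lemma self_adjoint_scaleR_id: "self_adjoint (r *\<^sub>R id_blinfun)"
  by (simp add: self_adjoint_iff bounded_ops_def blinfun.scaleR_left scaleC_scaleC mult.commute
      flip: scaleC_of_real)
    (simp add: scaleC_of_real)

lemma abs_inner_blinfun_le: "\<bar>inner (blinfun_apply T x) x\<bar> \<le> norm T * (norm x)\<^sup>2"
proof -
  have "\<bar>inner (T x) x\<bar> \<le> norm (T x) * norm x"
    by (rule Cauchy_Schwarz_ineq2)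
  also have "\<dots> \<le> norm T * norm x * norm x"
    by (intro mult_right_mono norm_blinfun) simp
  finally show ?thesis by (simp add: power2_eq_square mult.assoc)
qed

text \<open>The quadratic form of the conjugate at \<open>x\<close> is that of \<open>T\<close> at
  \<open>V x\<close>. This yields the positive arguments to which \<Phi> is applied later.\<close>

lemma positive_op_conjugate:
  assumes "positive_op T" "self_adjoint V"
  shows "positive_op (V o\<^sub>L T o\<^sub>L V)"
proof -
  have "self_adjoint (V o\<^sub>L T o\<^sub>L V)"
    using assms by (simp add: positive_op_iff self_adjoint_iff bounded_ops_def)
  moreover have "inner ((V o\<^sub>L T o\<^sub>L V) x) x = inner (T (V x)) (V x)" for x
    using assms(2) by (simp add: self_adjoint_iff)
  ultimately show ?thesis
    using assms(1) by (simp add: positive_op_iff)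
qed

lemma positive_op_square: "self_adjoint V \<Longrightarrow> positive_op (V o\<^sub>L V)"
  using positive_op_conjugate[of id_blinfun V] self_adjoint_scaleR_id[of 1]
  by (simp add: positive_op_iff)

text \<open>Expand \<open>\<langle>T z, z\<rangle> \<ge> 0\<close> at \<open>z = x - T x / M\<close>.\<close>

lemma positive_op_norm_apply_le:
  assumes T: "positive_op T" and M: "norm T \<le> M" "0 < M"
  shows "(norm (T x))\<^sup>2 \<le> M * inner (T x) x"
proof -
  define y where "y = T x"
  have "0 \<le> inner (T (x - (1/M) *\<^sub>R y)) (x - (1/M) *\<^sub>R y)"
    using T by (simp add: positive_op_iff)
  also have "\<dots> = inner y x - (1/M) * inner y y - (1/M) * inner (T y) x + (1/M)\<^sup>2 * inner (T y) y"
    by (simp add: y_def blinfun.diff_right blinfun.scaleR_right inner_diff algebra_simps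
        power2_eq_square)
  also have "inner (T y) x = inner y y"
    using T by (simp add: positive_op_iff self_adjoint_iff y_def)
  \<comment> \<open>The quadratic term gives back at most one of the two copies of
    \<open>inner y y / M\<close> that are subtracted.\<close>
  also have "(1/M)\<^sup>2 * inner (T y) y \<le> (1/M)\<^sup>2 * (M * inner y y)"
    using abs_inner_blinfun_le[of T y] mult_right_mono[OF M(1), of "(norm y)\<^sup>2"]
    by (intro mult_left_mono) (simp_all add: power2_norm_eq_inner)
  finally have "0 \<le> inner y x - 2 * (1/M) * inner y y + (1/M)\<^sup>2 * (M * inner y y)"
    by simp
  also have "\<dots> = inner y x - inner y y / M"
    using M by (simp add: power2_eq_square)
  finally show ?thesis
    using M by (simp add: y_def power2_norm_eq_inner field_simps)
qed

section \<open>Von Neumann algebras: algebraic closure, norm limits, inverses\<close>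

lemma von_neumann_algebra_bounded_ops: "von_neumann_algebra R \<Longrightarrow> T \<in> R \<Longrightarrow> T \<in> bounded_ops"
  and von_neumann_algebra_id: "von_neumann_algebra R \<Longrightarrow> id_blinfun \<in> R"
  and von_neumann_algebra_add:
    "von_neumann_algebra R \<Longrightarrow> T \<in> R \<Longrightarrow> U \<in> R \<Longrightarrow> T + U \<in> R"
  and von_neumann_algebra_compose:
    "von_neumann_algebra R \<Longrightarrow> T \<in> R \<Longrightarrow> U \<in> R \<Longrightarrow> T o\<^sub>L U \<in> R"
  by (auto simp: von_neumann_algebra_def)

lemma von_neumann_algebra_scaleR: "von_neumann_algebra R \<Longrightarrow> T \<in> R \<Longrightarrow> r *\<^sub>R T \<in> R"
  by (auto simp: von_neumann_algebra_def simp flip: scale_op_of_real)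

lemma von_neumann_algebra_diff:
  assumes "von_neumann_algebra R" "T \<in> R" "U \<in> R"
  shows "T - U \<in> R"
  using von_neumann_algebra_add[OF assms(1,2) von_neumann_algebra_scaleR[OF assms(1,3), of "-1"]]
  by simp

lemma von_neumann_algebra_sum:
  assumes "von_neumann_algebra R" "\<And>i. i \<in> I \<Longrightarrow> f i \<in> R"
  shows "sum f I \<in> R"
  using assms(2)
proof (induction I rule: infinite_finite_induct)
  case (insert i I)
  thus ?case by (simp add: von_neumann_algebra_add[OF assms(1)])
qed (use von_neumann_algebra_scaleR[OF assms(1) von_neumann_algebra_id[OF assms(1)], of 0] in simp_all)

text \<open>Norm convergence makes all matrix coefficients converge. A limit outside
  \<open>R\<close> would have a weakly open neighbourhood missing \<open>R\<close>, yet containing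
  some \<open>X n\<close>.\<close>

lemma von_neumann_algebra_LIMSEQ:
  fixes R :: "('h::chilbert_space \<Rightarrow>\<^sub>L 'h) set"
  assumes R: "von_neumann_algebra R" and X: "\<And>n. X n \<in> R" and lim: "X \<longlonglongrightarrow> L"
  shows "L \<in> R"
proof (rule ccontr)
  assume "L \<notin> R"
  have app: "(\<lambda>n. X n x) \<longlonglongrightarrow> L x" for x
    by (intro tendsto_intros lim)
  \<comment> \<open>The weak topology lives on \<open>bounded_ops\<close>, whereas a limit in the
    operator type is a priori only real-linear.\<close>
  have "L (c *\<^sub>C x) = c *\<^sub>C L x" for c x
  proof (rule LIMSEQ_unique[OF app])
    have "(\<lambda>n. c *\<^sub>C X n x) \<longlonglongrightarrow> c *\<^sub>C L x"
      by (rule bounded_linear.tendsto[OF bounded_linear_scaleC app])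
    thus "(\<lambda>n. X n (c *\<^sub>C x)) \<longlonglongrightarrow> c *\<^sub>C L x"
      using von_neumann_algebra_bounded_ops[OF R X] by (simp add: bounded_ops_def)
  qed
  hence L: "L \<in> bounded_ops" by (simp add: bounded_ops_def)
  define f :: "('h \<Rightarrow>\<^sub>L 'h) \<Rightarrow> 'h \<times> 'h \<Rightarrow> complex" where "f = (\<lambda>T (x, y). cinner (T x) y)"
  have "closedin weak_operator_topology R"
    using R by (simp add: von_neumann_algebra_def)
  moreover have "topspace (weak_operator_topology :: ('h \<Rightarrow>\<^sub>L 'h) topology) = bounded_ops"
    by (simp add: weak_operator_topology_def topspace_pullback_topology)
  ultimately have "openin weak_operator_topology (bounded_ops - R)"
    by (simp add: closedin_def)
  then obtain V where V: "open V" "bounded_ops - R = f -` V \<inter> bounded_ops"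
    by (auto simp: weak_operator_topology_def openin_pullback_topology f_def)
  have "(\<lambda>n. f (X n) p) \<longlonglongrightarrow> f L p" for p
    by (cases p) (auto simp: f_def cinner_eq_Complex intro!: tendsto_intros app)
  \<comment> \<open>Convergence in the product topology is pointwise convergence of the
    coefficients.\<close>
  hence "(\<lambda>n. f (X n)) \<longlonglongrightarrow> f L"
    by (simp add: limitin_componentwise flip: limitin_canonical_iff euclidean_product_topology)
  moreover have "f L \<in> V" using V L \<open>L \<notin> R\<close> by blast
  ultimately have "\<forall>\<^sub>F n in sequentially. f (X n) \<in> V"
    using V(1) by (simp add: topological_tendstoD)
  then obtain n where "f (X n) \<in> V"
    by (auto simp: eventually_sequentially)
  thus False
    using V(2) X[of n] von_neumann_algebra_bounded_ops[OF R X] by blast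
qed

text \<open>With \<open>M = \<parallel>B\<parallel> + 1\<close>, the operator \<open>I - B / M\<close> is a strict contraction, so that the Neumann
  series inverts \<open>B\<close> inside the algebra.\<close>

lemma von_neumann_algebra_inverse_bounded_below:
  fixes R :: "('h::chilbert_space \<Rightarrow>\<^sub>L 'h) set"
  assumes R: "von_neumann_algebra R" "B \<in> R" and B: "positive_op B"
    and c: "0 < c" "\<And>x. c * (norm x)\<^sup>2 \<le> inner (B x) x"
  shows "\<exists>U\<in>R. is_inverse_op B U"
proof -
  define M where "M = norm B + 1"
  have M: "norm B \<le> M" "0 < M" by (simp_all add: M_def add_nonneg_pos)
  define T where "T = id_blinfun - (1/M) *\<^sub>R B"
  \<comment> \<open>The computation below bounds \<open>(norm (T x))\<^sup>2\<close> by
    \<open>(1 - c/M) * (norm x)\<^sup>2\<close>. The factor can be negative only on the zero space,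
    whence the \<open>max 0\<close>.\<close>
  define q where "q = sqrt (max 0 (1 - c/M))"
  have q: "0 \<le> q" "q < 1" using c(1) M by (simp_all add: q_def)
  have norm_T: "norm T \<le> q"
  proof (rule norm_blinfun_bound[OF q(1)])
    fix x
    have "(norm (T x))\<^sup>2 = (norm x)\<^sup>2 - 2 * (1/M) * inner (B x) x + (1/M)\<^sup>2 * (norm (B x))\<^sup>2"
      unfolding power2_norm_eq_inner
      by (simp add: T_def blinfun.diff_left blinfun.scaleR_left inner_diff inner_commute
          power2_eq_square algebra_simps)
    \<comment> \<open>This cancels half of the negative cross term; the lower bound \<open>c\<close>
      then applies to the other half.\<close>
    also have "(1/M)\<^sup>2 * (norm (B x))\<^sup>2 \<le> (1/M)\<^sup>2 * (M * inner (B x) x)"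
      by (intro mult_left_mono positive_op_norm_apply_le[OF B M]) simp
    also have "(1/M)\<^sup>2 * (M * inner (B x) x) = (1/M) * inner (B x) x"
      using M by (simp add: power2_eq_square)
    finally have "(norm (T x))\<^sup>2 \<le> (norm x)\<^sup>2 - (1/M) * inner (B x) x"
      by simp
    also have "\<dots> \<le> (norm x)\<^sup>2 - (1/M) * (c * (norm x)\<^sup>2)"
      using M by (intro diff_mono mult_left_mono c) auto
    also have "\<dots> = (1 - c/M) * (norm x)\<^sup>2"
      by (simp add: algebra_simps)
    also have "\<dots> \<le> q\<^sup>2 * (norm x)\<^sup>2"
      by (intro mult_right_mono) (simp_all add: q_def)
    finally have "(norm (T x))\<^sup>2 \<le> (q * norm x)\<^sup>2"
      by (simp add: power_mult_distrib)
    thus "norm (T x) \<le> q * norm x"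
      by (rule power2_le_imp_le) (use q(1) in simp)
  qed
  define P where "P n = ((o\<^sub>L) T ^^ n) id_blinfun" for n
  have P_0: "P 0 = id_blinfun" and P_Suc: "P (Suc n) = T o\<^sub>L P n" for n
    by (simp_all add: P_def)
  \<comment> \<open>\<open>T\<close> commutes with its powers; splitting off a factor on either side
    makes the sum a two-sided inverse.\<close>
  have P_Suc': "P (Suc n) = P n o\<^sub>L T" for n
  proof -
    have "T (P n x) = P n (T x)" for x
      by (induction n) (simp_all add: P_0 P_Suc)
    thus ?thesis by (simp add: P_Suc blinfun_eqI)
  qed
  have T: "T \<in> R"
    unfolding T_def using R
    by (intro von_neumann_algebra_diff von_neumann_algebra_scaleR von_neumann_algebra_id)
  have P: "P n \<in> R" for n
    by (induction n) (simp_all add: P_0 P_Suc R T von_neumann_algebra_id von_neumann_algebra_compose)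
  have "norm (P n) \<le> q ^ n" for n
  proof (induction n)
    case 0
    show ?case by (simp add: P_0 norm_blinfun_id_le)
  next
    case (Suc n)
    have "norm (P (Suc n)) \<le> norm T * norm (P n)"
      unfolding P_Suc by (rule norm_blinfun_compose)
    also have "\<dots> \<le> q * q ^ n"
      by (intro mult_mono norm_T Suc q) simp
    finally show ?case by simp
  qed
  hence sum: "summable P"
    using q by (intro summable_comparison_test[OF _ summable_geometric[of q]]) auto
  define L where "L = suminf P"
  have tail: "(\<Sum>n. P (Suc n)) = L - id_blinfun"
    using suminf_split_head[OF sum] by (simp add: L_def P_0)
  have "T o\<^sub>L L = (\<Sum>n. P (Suc n))" unfolding L_def P_Suc
    by (rule bounded_linear.suminf[OF
          bounded_bilinear.bounded_linear_right[OF bounded_bilinear_blinfun_compose] sum])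
  hence TL: "T o\<^sub>L L = L - id_blinfun" by (simp add: tail)
  have "L o\<^sub>L T = (\<Sum>n. P (Suc n))" unfolding L_def P_Suc'
    by (rule bounded_linear.suminf[OF
          bounded_bilinear.bounded_linear_left[OF bounded_bilinear_blinfun_compose] sum])
  hence LT: "L o\<^sub>L T = L - id_blinfun" by (simp add: tail)
  have L: "L \<in> R"
    by (rule von_neumann_algebra_LIMSEQ[OF R(1) von_neumann_algebra_sum[OF R(1) P]
          summable_LIMSEQ[OF sum, folded L_def]])
  \<comment> \<open>As \<open>I - T = B / M\<close>, the identity \<open>TL\<close> says that
    \<open>B / M\<close> times \<open>L\<close> is the identity.\<close>
  have "B o\<^sub>L ((1/M) *\<^sub>R L) = id_blinfun"
  proof (rule blinfun_eqI)
    fix x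
    show "(B o\<^sub>L ((1/M) *\<^sub>R L)) x = id_blinfun x"
      using arg_cong[OF TL, of "\<lambda>F. F x"]
      by (simp add: T_def blinfun.diff_left blinfun.scaleR_left blinfun.scaleR_right)
  qed
  moreover have "((1/M) *\<^sub>R L) o\<^sub>L B = id_blinfun"
  proof (rule blinfun_eqI)
    fix x
    show "(((1/M) *\<^sub>R L) o\<^sub>L B) x = id_blinfun x"
      using arg_cong[OF LT, of "\<lambda>F. F x"]
      by (simp add: T_def blinfun.diff_left blinfun.diff_right blinfun.scaleR_left
          blinfun.scaleR_right)
  qed
  moreover have U: "(1/M) *\<^sub>R L \<in> R"
    by (rule von_neumann_algebra_scaleR[OF R(1) L])
  ultimately show ?thesis
    using von_neumann_algebra_bounded_ops[OF R(1) U] by (auto simp: is_inverse_op_def)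
qed

section \<open>Inverses of operators\<close>

lemma is_inverse_op_unique:
  assumes "is_inverse_op T U" "is_inverse_op T V"
  shows "U = V"
proof (rule blinfun_eqI)
  fix x
  have "T (V x) = x" "U (T (V x)) = V x"
    using assms unfolding is_inverse_op_def
    by (metis blinfun_apply_blinfun_compose blinfun_apply_id_blinfun)+
  thus "U x = V x" by simp
qed

lemma inverse_op_eq: "is_inverse_op T U \<Longrightarrow> inverse_op T = U"
  unfolding inverse_op_def by (blast intro: is_inverse_op_unique)

lemma is_inverse_op_apply:
  assumes "is_inverse_op T U"
  shows "T (U x) = x" "U (T x) = x"
  using assms unfolding is_inverse_op_def
  by (metis blinfun_apply_blinfun_compose blinfun_apply_id_blinfun)+

text \<open>This is the symmetry of \<open>T\<close> tested at \<open>U x\<close> and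
  \<open>U y\<close>.\<close>

lemma self_adjoint_inverse:
  assumes "self_adjoint T" "is_inverse_op T U"
  shows "self_adjoint U"
  unfolding self_adjoint_iff
proof (intro conjI allI)
  show "U \<in> bounded_ops" using assms(2) by (simp add: is_inverse_op_def)
  fix x y
  have "inner (T (U x)) (U y) = inner (U x) (T (U y))"
    using assms(1) by (simp add: self_adjoint_iff)
  thus "inner (U x) y = inner x (U y)"
    by (simp add: is_inverse_op_apply[OF assms(2)])
qed

text \<open>The inverse gives \<open>norm x \<le> K * norm (T x)\<close>, and
  \<open>positive_op_norm_apply_le\<close> bounds \<open>norm (T x)\<close> by the quadratic form.
  Unlike regularity itself, such a bound passes through a positive unital map.\<close>

lemma positive_regular_bounded_below:
  assumes T: "positive_op T" and U: "is_inverse_op T U"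
  obtains c where "0 < c" "\<And>x. c * (norm x)\<^sup>2 \<le> inner (T x) x"
proof -
  define M where "M = norm T + 1"
  define K where "K = norm U + 1"
  have M: "norm T \<le> M" "0 < M" and K: "norm U \<le> K" "0 < K"
    by (simp_all add: M_def K_def add_nonneg_pos)
  show thesis
  proof
    show "0 < 1 / (M * K\<^sup>2)" using M K by simp
    fix x
    have "norm x = norm (U (T x))" by (simp add: is_inverse_op_apply[OF U])
    also have "\<dots> \<le> norm U * norm (T x)" by (rule norm_blinfun)
    also have "\<dots> \<le> K * norm (T x)" using K by (intro mult_right_mono) auto
    finally have "(norm x)\<^sup>2 \<le> (K * norm (T x))\<^sup>2" by (intro power_mono) auto
    also have "\<dots> = K\<^sup>2 * (norm (T x))\<^sup>2" by (simp add: power_mult_distrib)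
    also have "\<dots> \<le> K\<^sup>2 * (M * inner (T x) x)"
      by (intro mult_left_mono positive_op_norm_apply_le[OF T M]) simp
    finally show "1 / (M * K\<^sup>2) * (norm x)\<^sup>2 \<le> inner (T x) x"
      using M K by (simp add: field_simps)
  qed
qed

theorem theorem4p4:
  fixes R S :: "('h :: {chilbert_space, second_countable_topology} \<Rightarrow>\<^sub>L 'h) set"
    and \<tau> :: "('h \<Rightarrow>\<^sub>L 'h) \<Rightarrow> complex"
    and \<Phi> :: "('h \<Rightarrow>\<^sub>L 'h) \<Rightarrow> ('h \<Rightarrow>\<^sub>L 'h)"
    and A :: "'h \<Rightarrow>\<^sub>L 'h"
  assumes "finite_von_neumann_algebra R"
    and "faithful_normal_tracial_state R \<tau>"
    and "von_neumann_algebra S" and "S \<subseteq> R"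
    and "conditional_expectation R S \<Phi>" and "\<Phi> ` R = S"
    and "trace_preserving R \<tau> \<Phi>"
    and "A \<in> R"
  shows "(self_adjoint A \<longrightarrow>
            \<Phi> A o\<^sub>L \<Phi> A \<preceq> \<Phi> (A o\<^sub>L A) \<and>
            (\<Phi> A o\<^sub>L \<Phi> A = \<Phi> (A o\<^sub>L A) \<longleftrightarrow> \<Phi> A = A)) \<and>
         (positive_op A \<and> regular_op A \<longrightarrow>
            inverse_op A \<in> R \<and> regular_op (\<Phi> A) \<and>
            inverse_op (\<Phi> A) \<preceq> \<Phi> (inverse_op A) \<and>
            (inverse_op (\<Phi> A) = \<Phi> (inverse_op A) \<longleftrightarrow> \<Phi> A = A)) \<and>
         (\<Phi> A = A \<longleftrightarrow> A \<in> S)"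
proof -

  \<comment> \<open>Properties of the expectation and the trace\<close>
  have R: "von_neumann_algebra R"
    using assms(1) by (simp add: finite_von_neumann_algebra_def)
  note S = assms(3) and SR = subsetD[OF assms(4)]
  have \<Phi>_in: "\<Phi> T \<in> S" if "T \<in> R" for T
    using assms(5) that by (auto simp: conditional_expectation_def)
  have \<Phi>_add: "\<Phi> (T + U) = \<Phi> T + \<Phi> U" if "T \<in> R" "U \<in> R" for T U
    using assms(5) that by (auto simp: conditional_expectation_def)
  have \<Phi>_scaleR: "\<Phi> (r *\<^sub>R T) = r *\<^sub>R \<Phi> T" if "T \<in> R" for r T
    using assms(5) that by (auto simp: conditional_expectation_def simp flip: scale_op_of_real)
  have \<Phi>_diff: "\<Phi> (T - U) = \<Phi> T - \<Phi> U" if "T \<in> R" "U \<in> R" for T U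
    using \<Phi>_add[OF von_neumann_algebra_diff[OF R that] that(2)] by simp
  have \<Phi>_pos: "positive_op (\<Phi> T)" if "T \<in> R" "positive_op T" for T
    using assms(5) that by (auto simp: conditional_expectation_def)
  have \<Phi>_id: "\<Phi> id_blinfun = id_blinfun"
    using assms(5) by (simp add: conditional_expectation_def)
  have \<Phi>_bimodule: "\<Phi> (U o\<^sub>L T o\<^sub>L V) = U o\<^sub>L \<Phi> T o\<^sub>L V" if "T \<in> R" "U \<in> S" "V \<in> S" for T U V
    using assms(5) that by (auto simp: conditional_expectation_def)
  have \<Phi>_left: "\<Phi> (U o\<^sub>L T) = U o\<^sub>L \<Phi> T" if "T \<in> R" "U \<in> S" for T U
    using \<Phi>_bimodule[OF that von_neumann_algebra_id[OF S]] by simp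
  have \<Phi>_right: "\<Phi> (T o\<^sub>L V) = \<Phi> T o\<^sub>L V" if "T \<in> R" "V \<in> S" for T V
    using \<Phi>_bimodule[OF that(1) von_neumann_algebra_id[OF S] that(2)] by simp
  \<comment> \<open>Write \<open>T\<close> as \<open>T\<close> times the identity and pull
    \<open>T\<close> out of \<Phi>, which is unital.\<close>
  have \<Phi>_S: "\<Phi> T = T" if "T \<in> S" for T
    using \<Phi>_left[OF von_neumann_algebra_id[OF R] that] by (simp add: \<Phi>_id)
  \<comment> \<open>Trace preservation gives \<open>\<tau> T = \<tau> 0 = 0\<close>, the last
    equality by homogeneity at the scalar 0; then \<tau> is faithful.\<close>
  have \<Phi>_faithful: "T = 0" if "T \<in> R" "positive_op T" "\<Phi> T = 0" for T
  proof -
    have "\<tau> (scale_op 0 T) = 0 * \<tau> T"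
      using assms(2) that by (simp add: faithful_normal_tracial_state_def state_on_def)
    hence "\<tau> 0 = 0"
      using scale_op_of_real[of 0 T] by simp
    hence "\<tau> T = 0"
      using assms(7) that by (auto simp: trace_preserving_def)
    thus ?thesis
      using assms(2) that by (auto simp: faithful_normal_tracial_state_def faithful_on_def)
  qed
  note compose = von_neumann_algebra_compose and diff = von_neumann_algebra_diff
  note [simp] = bounded_bilinear.diff_left[OF bounded_bilinear_blinfun_compose]
    bounded_bilinear.diff_right[OF bounded_bilinear_blinfun_compose]
  define B where "B = \<Phi> A"
  have A: "A \<in> R" and BS: "B \<in> S" and BR: "B \<in> R"
    using assms(8) \<Phi>_in SR by (auto simp: B_def)
  have fix_iff: "B = A \<longleftrightarrow> A \<in> S"
    using \<Phi>_S BS by (auto simp: B_def)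
  have I: "r *\<^sub>R id_blinfun \<in> R" for r
    by (intro von_neumann_algebra_scaleR von_neumann_algebra_id R)

  \<comment> \<open>The inequality for squares\<close>
  have square: "B o\<^sub>L B \<preceq> \<Phi> (A o\<^sub>L A) \<and> (B o\<^sub>L B = \<Phi> (A o\<^sub>L A) \<longleftrightarrow> B = A)"
    if sa: "self_adjoint A"
  proof -
    \<comment> \<open>Positivity of \<Phi> says nothing directly about a self-adjoint
      \<open>A\<close>. The shift by \<open>norm A\<close> makes it positive, and removing the shift
      afterwards shows \<open>B\<close> self-adjoint.\<close>
    define r where "r = norm A"
    have "positive_op (A + r *\<^sub>R id_blinfun)"
      unfolding positive_op_iff
    proof (intro conjI allI)
      fix x
      show "0 \<le> inner ((A + r *\<^sub>R id_blinfun) x) x"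
        using abs_inner_blinfun_le[of A x]
        by (simp add: r_def blinfun.add_left blinfun.scaleR_left inner_add power2_norm_eq_inner)
    qed (intro self_adjoint_add sa self_adjoint_scaleR_id)
    from \<Phi>_pos[OF von_neumann_algebra_add[OF R A I] this]
    have "self_adjoint (B + r *\<^sub>R id_blinfun)"
      by (simp add: positive_op_iff \<Phi>_add A I \<Phi>_scaleR von_neumann_algebra_id R \<Phi>_id B_def)
    from self_adjoint_diff[OF this self_adjoint_scaleR_id[of r]]
    have saB: "self_adjoint B" by simp
    define E where "E = A - B"
    have saE: "self_adjoint E" and E: "E \<in> R"
      using self_adjoint_diff[OF sa saB] diff[OF R A BR] by (simp_all add: E_def)
    \<comment> \<open>Both mixed products and \<open>B o\<^sub>L B\<close> itself are sent to
      \<open>B o\<^sub>L B\<close>, so one copy survives with a minus sign.\<close>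
    have "E o\<^sub>L E = ((A o\<^sub>L A) - (B o\<^sub>L A)) - ((A o\<^sub>L B) - (B o\<^sub>L B))"
      by (simp add: E_def)
    also have "\<Phi> \<dots> = \<Phi> (A o\<^sub>L A) - (B o\<^sub>L B)"
      by (simp add: \<Phi>_diff \<Phi>_left \<Phi>_right \<Phi>_S A BR BS diff compose R S flip: B_def)
    finally have \<Phi>E: "\<Phi> (E o\<^sub>L E) = \<Phi> (A o\<^sub>L A) - (B o\<^sub>L B)" .
    have EE: "E o\<^sub>L E \<in> R" "positive_op (E o\<^sub>L E)"
      using compose[OF R E E] positive_op_square[OF saE] by auto
    have "B = A" if "B o\<^sub>L B = \<Phi> (A o\<^sub>L A)"
    proof -
      have "E o\<^sub>L E = 0"
        using \<Phi>_faithful[OF EE] \<Phi>E that by simp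
      hence "inner (E (E x)) x = 0" for x
        by (metis blinfun_apply_blinfun_compose blinfun.zero_left inner_zero_left)
      hence "inner (E x) (E x) = 0" for x
        using saE by (metis self_adjoint_iff)
      hence "E x = 0" for x by simp
      thus "B = A"
        by (intro blinfun_eqI) (simp add: E_def blinfun.diff_left)
    qed
    moreover have "B o\<^sub>L B = \<Phi> (A o\<^sub>L A)" if "B = A"
      using \<Phi>_S[OF compose[OF S BS BS]] that by simp
    ultimately show ?thesis
      using \<Phi>_pos[OF EE] by (auto simp: op_le_def \<Phi>E)
  qed

  \<comment> \<open>The inequality for inverses\<close>
  have inverse: "inverse_op A \<in> R \<and> regular_op B \<and> inverse_op B \<preceq> \<Phi> (inverse_op A) \<and>
      (inverse_op B = \<Phi> (inverse_op A) \<longleftrightarrow> B = A)"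
    if pos: "positive_op A" and reg: "regular_op A"
  proof -
    have saA: "self_adjoint A" using pos by (simp add: positive_op_iff)
    obtain D where D: "is_inverse_op A D" using reg by (auto simp: regular_op_def)
    obtain c where c: "0 < c" "\<And>x. c * (norm x)\<^sup>2 \<le> inner (A x) x"
      using positive_regular_bounded_below[OF pos D] by blast
    \<comment> \<open>Uniqueness identifies \<open>D\<close> with the inverse built inside
      \<open>N\<close>. The case \<open>N = R\<close> makes \<open>\<Phi> D\<close> available;
      \<open>N = S\<close> serves the equality case.\<close>
    have D_mem: "D \<in> N" if "von_neumann_algebra N" "A \<in> N" for N
      using von_neumann_algebra_inverse_bounded_below[OF that pos c] is_inverse_op_unique[OF D]
      by blast
    have DR: "D \<in> R" by (rule D_mem[OF R A])
    \<comment> \<open>The lower bound \<open>c\<close> is carried from \<open>A\<close> to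
      \<open>B\<close> by positivity and unitality, so \<open>B\<close> gets an inverse inside
      \<open>S\<close>.\<close>
    have "positive_op (A - c *\<^sub>R id_blinfun)"
      using c self_adjoint_diff[OF saA self_adjoint_scaleR_id]
      by (simp add: positive_op_iff blinfun.diff_left blinfun.scaleR_left inner_diff
          power2_norm_eq_inner)
    from \<Phi>_pos[OF diff[OF R A I] this]
    have "positive_op (B - c *\<^sub>R id_blinfun)"
      by (simp add: \<Phi>_diff A I \<Phi>_scaleR von_neumann_algebra_id R \<Phi>_id B_def)
    hence cB: "c * (norm x)\<^sup>2 \<le> inner (B x) x" for x
      by (simp add: positive_op_iff blinfun.diff_left blinfun.scaleR_left inner_diff
          power2_norm_eq_inner)
    have posB: "positive_op B"
      using \<Phi>_pos[OF A pos] by (simp add: B_def)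
    hence saB: "self_adjoint B" by (simp add: positive_op_iff)
    obtain C where CS: "C \<in> S" and C: "is_inverse_op B C"
      using von_neumann_algebra_inverse_bounded_below[OF S BS posB c(1) cB] by blast
    have CR: "C \<in> R" by (rule SR[OF CS])
    define E where "E = D - C"
    have saE: "self_adjoint E" and E: "E \<in> R"
      using self_adjoint_inverse[OF saA D] self_adjoint_inverse[OF saB C] diff[OF R DR CR]
      by (simp_all add: E_def self_adjoint_diff)
    \<comment> \<open>\<open>D\<close> cancels \<open>A\<close> in three of the four products. In
      the fourth, \<Phi> replaces \<open>A\<close> by \<open>B\<close>, leaving
      \<open>C o\<^sub>L B o\<^sub>L C = C\<close>.\<close>
    have "E o\<^sub>L A o\<^sub>L E = D - C - (C - (C o\<^sub>L A o\<^sub>L C))"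
      by (rule blinfun_eqI)
        (simp add: E_def blinfun.diff_left blinfun.diff_right is_inverse_op_apply[OF D])
    also have "\<Phi> \<dots> = \<Phi> D - C - (C - (C o\<^sub>L B o\<^sub>L C))"
      by (simp add: \<Phi>_diff \<Phi>_bimodule \<Phi>_S A CR CS DR diff compose R S flip: B_def)
    also have "C o\<^sub>L B = id_blinfun" using C by (simp add: is_inverse_op_def)
    finally have \<Phi>E: "\<Phi> (E o\<^sub>L A o\<^sub>L E) = \<Phi> D - C" by simp
    have EAE: "E o\<^sub>L A o\<^sub>L E \<in> R" "positive_op (E o\<^sub>L A o\<^sub>L E)"
      using compose[OF R compose[OF R E A] E] positive_op_conjugate[OF pos saE] by auto
    have "B = A" if "C = \<Phi> D"
    proof -
      have "E o\<^sub>L A o\<^sub>L E = 0"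
        using \<Phi>_faithful[OF EAE] \<Phi>E that by simp
      hence "inner (E (A (E x))) x = 0" for x
        by (metis blinfun_apply_blinfun_compose blinfun.zero_left inner_zero_left)
      hence "inner (A (E x)) (E x) = 0" for x
        using saE by (metis self_adjoint_iff)
      \<comment> \<open>The lower bound on \<open>A\<close> turns the vanishing of its form at
        \<open>E x\<close> into \<open>E x = 0\<close>.\<close>
      hence "c * (norm (E x))\<^sup>2 \<le> 0" for x
        using c(2)[of "E x"] by simp
      hence "E x = 0" for x
        using c(1) by (simp add: mult_le_0_iff)
      hence DC: "D x = C x" for x
        by (simp add: E_def blinfun.diff_left)
      show "B = A"
      proof (rule blinfun_eqI)
        fix x
        \<comment> \<open>Replacing \<open>D\<close> by \<open>C\<close> here cancels
          \<open>B\<close> and leaves \<open>A x\<close>.\<close>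
        have "B x = B (D (A x))" by (simp add: is_inverse_op_apply[OF D])
        thus "B x = A x" by (simp add: DC is_inverse_op_apply[OF C])
      qed
    qed
    \<comment> \<open>Now \<open>A\<close> lies in \<open>S\<close>, hence so does \<open>D\<close>;
      \<Phi> fixes it, and it equals \<open>C\<close> by uniqueness of inverses.\<close>
    moreover have "C = \<Phi> D" if "B = A"
      using \<Phi>_S[OF D_mem[OF S]] is_inverse_op_unique[OF D] C BS that by simp
    ultimately show ?thesis
      using \<Phi>_pos[OF EAE] C DR
      by (auto simp: op_le_def \<Phi>E inverse_op_eq[OF C] inverse_op_eq[OF D] regular_op_def)
  qed

  show ?thesis
    using square inverse fix_iff unfolding B_def by blast
qed

end
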